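(* Alternating up-down replacement selection is 2-competitive: for every input $I$, its output $S$ satisfies $R(S)\le 2\,\mathrm{OPT}(I)$.
   Context: Up-down run generation problem: an input stream $I$ of $N$ elements from a totally ordered set (duplicates allowed) is presented in order to an algorithm with a buffer of $M$ slots. The algorithm reads elements one by one from $I$ into the buffer and writes elements from the buffer, appending them to an output sequence $S$; each written element frees its slot, which is filled by the next input element. A run is a sorted (increasing) or reverse-sorted (decreasing) sequence. $R(S)$ is the smallest $k$ such that $S$ is a concatenation of $k$ runs; $\mathrm{OPT}(I)$ is the minimum of $R(S)$ over all possible outputs of (offline) algorithms with buffer size $M$ on $I$. A maximal increasing run is written as follows: start with the smallest element in the buffer, always write the smallest buffered element larger than the last element written, and end the run only when every buffered element is smaller than the last element written; a maximal decreasing run is symmetric. Alternating up-down replacement selection (buffer size $M$) writes a maximal increasing run, then a maximal decreasing run, then a maximal increasing run, and so on, alternating until all elements are written. An algorithm is $\beta$-competitive if $R(S)\le\beta\,\mathrm{OPT}(I)$ on every input. *)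

theory Defs
  imports Complex_Main "HOL-Library.Multiset"
begin

text \<open>
  A state of a run generation algorithm is a pair of the current buffer contents and the
  unread input. Duplicates are allowed, so the buffer is a multiset.
\<close>

type_synonym 'a state = "'a multiset \<times> 'a list"

definition initial :: "nat \<Rightarrow> 'a list \<Rightarrow> 'a state" where
  "initial M I = (mset (take M I), drop M I)"

text \<open>Writing \<open>x\<close> frees its slot, which the next input element (if there is one) takes.\<close>

fun write_elem :: "'a \<Rightarrow> 'a state \<Rightarrow> 'a state" where
  "write_elem x (B, I) = (B - {#x#} + mset (take 1 I), drop 1 I)"

text \<open>\<open>outputs s S\<close>: by some sequence of choices of which buffered element to write, all the
  elements still held in \<open>s\<close> are written, in the order \<open>S\<close>.\<close>

inductive outputs :: "'a state \<Rightarrow> 'a list \<Rightarrow> bool" where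
  outputs_Nil: "outputs ({#}, []) []"
| outputs_Cons: "x \<in># fst s \<Longrightarrow> outputs (write_elem x s) S \<Longrightarrow> outputs s (x # S)"

definition is_run :: "'a::linorder list \<Rightarrow> bool" where
  "is_run r \<longleftrightarrow> sorted r \<or> sorted (rev r)"

definition num_runs :: "'a::linorder list \<Rightarrow> nat" where
  "num_runs S = (LEAST k. \<exists>rs. length rs = k \<and> concat rs = S \<and> (\<forall>r\<in>set rs. is_run r))"

definition opt_runs :: "nat \<Rightarrow> 'a::linorder list \<Rightarrow> nat" where
  "opt_runs M I = (LEAST k. \<exists>S. outputs (initial M I) S \<and> num_runs S = k)"

definition competitive ::
  "nat \<Rightarrow> real \<Rightarrow> ('a::linorder list \<Rightarrow> 'a list) \<Rightarrow> bool" where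
  "competitive M \<beta> A \<longleftrightarrow> (\<forall>I. real (num_runs (A I)) \<le> \<beta> * real (opt_runs M I))"

abbreviation (input) state_size :: "'a state \<Rightarrow> nat" where
  "state_size s \<equiv> size (fst s) + length (snd s)"

lemma state_size_write_elem:
  assumes "x \<in># fst s"
  shows "state_size s = Suc (state_size (write_elem x s))"
proof -
  obtain B I where s: "s = (B, I)" by (cases s)
  have "size B = Suc (size (B - {#x#}))"
    using assms s by (metis fst_conv insert_DiffM size_add_mset)
  then show ?thesis by (cases I) (simp_all add: s)
qed

text \<open>
  Continuation of a maximal increasing (decreasing) run whose last written element is \<open>l\<close>;
  the result is the list of elements written and the state in which the run ends. Runs are
  only weakly monotone, so an element equal to \<open>l\<close> can still be written: the run ends exactly
  when every buffered element is strictly smaller (larger) than \<open>l\<close>.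
\<close>

function up_from :: "'a::linorder \<Rightarrow> 'a state \<Rightarrow> 'a list \<times> 'a state" where
  "up_from l s =
     (if \<exists>x. x \<in># fst s \<and> l \<le> x then
        let x = Min {x. x \<in># fst s \<and> l \<le> x}; (r, s') = up_from x (write_elem x s)
        in (x # r, s')
      else ([], s))"
  by pat_completeness auto

function down_from :: "'a::linorder \<Rightarrow> 'a state \<Rightarrow> 'a list \<times> 'a state" where
  "down_from l s =
     (if \<exists>x. x \<in># fst s \<and> x \<le> l then
        let x = Max {x. x \<in># fst s \<and> x \<le> l}; (r, s') = down_from x (write_elem x s)
        in (x # r, s')
      else ([], s))"
  by pat_completeness auto

lemma Min_next:
  assumes "\<exists>x. x \<in># B \<and> l \<le> (x::'a::linorder)"
  shows "Min {x. x \<in># B \<and> l \<le> x} \<in># B" "l \<le> Min {x. x \<in># B \<and> l \<le> x}"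
proof -
  have "Min {x. x \<in># B \<and> l \<le> x} \<in> {x. x \<in># B \<and> l \<le> x}"
    using assms by (intro Min_in) auto
  then show "Min {x. x \<in># B \<and> l \<le> x} \<in># B" "l \<le> Min {x. x \<in># B \<and> l \<le> x}" by auto
qed

lemma Max_next:
  assumes "\<exists>x. x \<in># B \<and> x \<le> (l::'a::linorder)"
  shows "Max {x. x \<in># B \<and> x \<le> l} \<in># B" "Max {x. x \<in># B \<and> x \<le> l} \<le> l"
proof -
  have "Max {x. x \<in># B \<and> x \<le> l} \<in> {x. x \<in># B \<and> x \<le> l}"
    using assms by (intro Max_in) auto
  then show "Max {x. x \<in># B \<and> x \<le> l} \<in># B" "Max {x. x \<in># B \<and> x \<le> l} \<le> l" by auto
qed

termination up_from
  by (relation "measure (\<lambda>(l, s). state_size s)")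
     (use state_size_write_elem Min_next(1) in \<open>force+\<close>)

termination down_from
  by (relation "measure (\<lambda>(l, s). state_size s)")
     (use state_size_write_elem Max_next(1) in \<open>force+\<close>)

declare up_from.simps [simp del] down_from.simps [simp del]

text \<open>
  A run starts with the smallest (largest) buffered element. Taking that element itself as
  the bound \<open>l\<close> makes it the first one written.
\<close>

definition up_run :: "'a::linorder state \<Rightarrow> 'a list \<times> 'a state" where
  "up_run s = up_from (Min_mset (fst s)) s"

definition down_run :: "'a::linorder state \<Rightarrow> 'a list \<times> 'a state" where
  "down_run s = down_from (Max_mset (fst s)) s"

lemma up_from_stop: "\<not> (\<exists>x. x \<in># fst s \<and> l \<le> x) \<Longrightarrow> up_from l s = ([], s)"
  by (subst up_from.simps) (simp only: if_False)

lemma up_from_step: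
  "\<exists>x. x \<in># fst s \<and> l \<le> x \<Longrightarrow> x = Min {x. x \<in># fst s \<and> l \<le> x} \<Longrightarrow>
     up_from x (write_elem x s) = (r, s') \<Longrightarrow> up_from l s = (x # r, s')"
  by (subst up_from.simps) simp

lemma up_from_elem_induct:
  assumes "up_from l s = (r, s')"
    and stop: "\<And>s. Q s [] s"
    and step: "\<And>x s r s'. x \<in># fst s \<Longrightarrow> Q (write_elem x s) r s' \<Longrightarrow> Q s (x # r) s'"
  shows "Q s r s'"
  using assms(1)
proof (induction l s arbitrary: r s' rule: up_from.induct)
  case (1 l s)
  show ?case
  proof (cases "\<exists>x. x \<in># fst s \<and> l \<le> x")
    case True
    define x where "x = Min {x. x \<in># fst s \<and> l \<le> x}"
    obtain r1 s1 where rec: "up_from x (write_elem x s) = (r1, s1)" by (rule prod.exhaust)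
    have "r = x # r1" "s' = s1"
      using 1(2) up_from_step[OF True x_def rec] by auto
    moreover have "x \<in># fst s"
      using Min_next(1)[OF True] unfolding x_def .
    ultimately show ?thesis
      using step 1(1)[OF True x_def rec] by blast
  next
    case False
    then show ?thesis using 1(2) up_from_stop[OF False] stop by auto
  qed
qed

lemma down_from_stop: "\<not> (\<exists>x. x \<in># fst s \<and> x \<le> l) \<Longrightarrow> down_from l s = ([], s)"
  by (subst down_from.simps) (simp only: if_False)

lemma down_from_step:
  "\<exists>x. x \<in># fst s \<and> x \<le> l \<Longrightarrow> x = Max {x. x \<in># fst s \<and> x \<le> l} \<Longrightarrow>
     down_from x (write_elem x s) = (r, s') \<Longrightarrow> down_from l s = (x # r, s')"
  by (subst down_from.simps) simp

lemma down_from_elem_induct: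
  assumes "down_from l s = (r, s')"
    and stop: "\<And>s. Q s [] s"
    and step: "\<And>x s r s'. x \<in># fst s \<Longrightarrow> Q (write_elem x s) r s' \<Longrightarrow> Q s (x # r) s'"
  shows "Q s r s'"
  using assms(1)
proof (induction l s arbitrary: r s' rule: down_from.induct)
  case (1 l s)
  show ?case
  proof (cases "\<exists>x. x \<in># fst s \<and> x \<le> l")
    case True
    define x where "x = Max {x. x \<in># fst s \<and> x \<le> l}"
    obtain r1 s1 where rec: "down_from x (write_elem x s) = (r1, s1)" by (rule prod.exhaust)
    have "r = x # r1" "s' = s1"
      using 1(2) down_from_step[OF True x_def rec] by auto
    moreover have "x \<in># fst s"
      using Max_next(1)[OF True] unfolding x_def .
    ultimately show ?thesis
      using step 1(1)[OF True x_def rec] by blast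
  next
    case False
    then show ?thesis using 1(2) down_from_stop[OF False] stop by auto
  qed
qed

lemma write_elem_inv: "fst (write_elem x s) = {#} \<Longrightarrow> snd (write_elem x s) = []"
  by (cases s; cases "snd s") auto

lemma up_from_size: "up_from l s = (r, s') \<Longrightarrow> state_size s = length r + state_size s'"
  by (erule up_from_elem_induct) (auto dest: state_size_write_elem)

lemma up_from_outputs:
  assumes "up_from l s = (r, s')" "outputs s' S"
  shows "outputs s (r @ S)"
proof -
  have "outputs s' S \<longrightarrow> outputs s (r @ S)"
    using assms(1) by (rule up_from_elem_induct) (auto intro: outputs_Cons)
  then show ?thesis using assms(2) by simp
qed

lemma up_from_inv:
  assumes "fst s = {#} \<longrightarrow> snd s = []" "up_from l s = (r, s')"
  shows "fst s' = {#} \<longrightarrow> snd s' = []"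
proof -
  have "(fst s = {#} \<longrightarrow> snd s = []) \<longrightarrow> (fst s' = {#} \<longrightarrow> snd s' = [])"
    using assms(2) by (rule up_from_elem_induct) (auto dest: write_elem_inv)
  then show ?thesis using assms(1) by simp
qed

lemma down_from_size: "down_from l s = (r, s') \<Longrightarrow> state_size s = length r + state_size s'"
  by (erule down_from_elem_induct) (auto dest: state_size_write_elem)

lemma down_from_outputs:
  assumes "down_from l s = (r, s')" "outputs s' S"
  shows "outputs s (r @ S)"
proof -
  have "outputs s' S \<longrightarrow> outputs s (r @ S)"
    using assms(1) by (rule down_from_elem_induct) (auto intro: outputs_Cons)
  then show ?thesis using assms(2) by simp
qed

lemma down_from_inv:
  assumes "fst s = {#} \<longrightarrow> snd s = []" "down_from l s = (r, s')"
  shows "fst s' = {#} \<longrightarrow> snd s' = []"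
proof -
  have "(fst s = {#} \<longrightarrow> snd s = []) \<longrightarrow> (fst s' = {#} \<longrightarrow> snd s' = [])"
    using assms(2) by (rule down_from_elem_induct) (auto dest: write_elem_inv)
  then show ?thesis using assms(1) by simp
qed

lemma up_run_nonempty:
  assumes "fst s \<noteq> {#}" "up_run s = (r, s')"
  shows "r \<noteq> []"
proof -
  have "\<exists>x. x \<in># fst s \<and> Min_mset (fst s) \<le> x"
    using assms(1) by (metis Min_in finite_set_mset order_refl set_mset_eq_empty_iff)
  then show ?thesis
    using assms(2) unfolding up_run_def up_from.simps[of _ s] by (auto simp: Let_def split: prod.splits)
qed

lemma down_run_nonempty:
  assumes "fst s \<noteq> {#}" "down_run s = (r, s')"
  shows "r \<noteq> []"
proof -
  have "\<exists>x. x \<in># fst s \<and> x \<le> Max_mset (fst s)"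
    using assms(1) by (metis Max_in finite_set_mset order_refl set_mset_eq_empty_iff)
  then show ?thesis
    using assms(2) unfolding down_run_def down_from.simps[of _ s] by (auto simp: Let_def split: prod.splits)
qed

text \<open>The flag tells whether the next run to be written is increasing.\<close>

function alternate :: "bool \<Rightarrow> 'a::linorder state \<Rightarrow> 'a list" where
  "alternate up s =
     (if fst s = {#} then []
      else let (r, s') = (if up then up_run s else down_run s) in r @ alternate (\<not> up) s')"
  by pat_completeness auto

lemma alternate_size:
  assumes "fst s \<noteq> {#}" "(if up then up_run s else down_run s) = (r, s')"
  shows "state_size s' < state_size s"
proof (cases up)
  case True
  then have u: "up_run s = (r, s')" using assms(2) by simp
  show ?thesis
    using up_run_nonempty[OF assms(1) u] up_from_size[OF u[unfolded up_run_def]] by (cases r) auto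
next
  case False
  then have d: "down_run s = (r, s')" using assms(2) by simp
  show ?thesis
    using down_run_nonempty[OF assms(1) d] down_from_size[OF d[unfolded down_run_def]] by (cases r) auto
qed

termination alternate
proof (relation "measure (\<lambda>(up, s). state_size s)", goal_cases)
  case (2 up s p r s')
  then show ?case using alternate_size[of s up r s'] by simp
qed simp

declare alternate.simps [simp del]

definition updown_rs :: "nat \<Rightarrow> 'a::linorder list \<Rightarrow> 'a list" where
  "updown_rs M I = alternate True (initial M I)"

lemma alternate_outputs:
  "(fst s = {#} \<longrightarrow> snd s = []) \<Longrightarrow> outputs s (alternate up s)"
proof (induction up s rule: alternate.induct)
  case (1 up s)
  show ?case
  proof (cases "fst s = {#}")
    case True
    then have "s = ({#}, [])" using 1(2) by (cases s) simp
    then show ?thesis by (simp add: alternate.simps outputs_Nil)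
  next
    case False
    obtain r s' where rs: "(if up then up_run s else down_run s) = (r, s')" by (rule prod.exhaust)
    have alt: "alternate up s = r @ alternate (\<not> up) s'"
      using False rs by (subst alternate.simps) simp
    have "fst s' = {#} \<longrightarrow> snd s' = []"
      using rs up_from_inv[OF 1(2)] down_from_inv[OF 1(2)]
      by (auto simp: up_run_def down_run_def split: if_splits)
    then have "outputs s' (alternate (\<not> up) s')"
      using 1(1)[OF False rs[symmetric] refl] by simp
    then show ?thesis
      unfolding alt using rs
      by (cases up)
        (auto simp: up_run_def down_run_def intro: up_from_outputs down_from_outputs)
  qed
qed

text \<open>
  The algorithm is a legitimate one, and in particular the minimum in \<^const>\<open>opt_runs\<close> is
  over a nonempty set.
\<close>

lemma updown_rs_outputs:
  assumes "M \<ge> 1"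
  shows "outputs (initial M I) (updown_rs M I)"
  unfolding updown_rs_def by (rule alternate_outputs) (use assms in \<open>auto simp: initial_def\<close>)

end

theory Submission
  imports Defs
begin

text \<open>
  Say that a state \<open>a\<close> dominates a state \<open>s\<close> of the same input stream if the multiset of
  elements not yet written in \<open>a\<close> is contained in that of \<open>s\<close>. As buffers are kept full, \<open>a\<close>
  has then read at least as far as \<open>s\<close>. If \<open>a\<close> dominates \<open>s\<close>, then the state after a maximal
  run from \<open>a\<close> dominates the state after an arbitrary run of the same direction from \<open>s\<close>: whenever
  the latter run writes \<open>x\<close>, either \<open>x\<close> is in the buffer of \<open>a\<close> and the maximal run can proceed up
  to \<open>x\<close>, or all unwritten copies of \<open>x\<close> in \<open>a\<close> are unread, so that the other state, which
  has a copy in its buffer, has strictly more of them. Hence two consecutive maximal runs of opposite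
  directions always catch up with one run of the optimum, whatever its direction.
\<close>

section \<open>Domination between states and its behaviour under single writes\<close>

definition unwritten :: "'a state \<Rightarrow> 'a multiset" where
  "unwritten s = fst s + mset (snd s)"

text \<open>The suffix clause ties states to one common stream \<open>I\<close>. A buffer may be
  short only once its input is exhausted, which lets counts of unwritten elements bound reading
  positions.\<close>

definition full_buffer :: "nat \<Rightarrow> 'a list \<Rightarrow> 'a state \<Rightarrow> bool" where
  "full_buffer M I s \<longleftrightarrow> (\<exists>n. snd s = drop n I) \<and> size (fst s) \<le> M \<and>
     (snd s \<noteq> [] \<longrightarrow> size (fst s) = M)"

definition dominates :: "nat \<Rightarrow> 'a list \<Rightarrow> 'a state \<Rightarrow> 'a state \<Rightarrow> bool" where
  "dominates M I a s \<longleftrightarrow> full_buffer M I a \<and> full_buffer M I s \<and> unwritten a \<subseteq># unwritten s"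

lemma full_buffer_initial: "full_buffer M I (initial M I)"
  by (auto simp: full_buffer_def initial_def)

lemma full_buffer_write_elem:
  assumes "full_buffer M I s" "x \<in># fst s"
  shows "full_buffer M I (write_elem x s)"
proof -
  obtain B J where s: "s = (B, J)" by (cases s)
  have sz: "size B = Suc (size (B - {#x#}))"
    using assms(2) s by (metis fst_conv insert_DiffM size_add_mset)
  obtain n where n: "J = drop n I" using assms(1) s by (auto simp: full_buffer_def)
  have "drop 1 J = drop (Suc n) I" unfolding n by simp
  then have "\<exists>n. drop 1 J = drop n I" by blast
  then show ?thesis
    using assms(1) sz by (cases J) (auto simp: full_buffer_def s)
qed

lemma unwritten_write_elem:
  assumes "x \<in># fst s"
  shows "unwritten s = add_mset x (unwritten (write_elem x s))"
proof -
  obtain B J where s: "s = (B, J)" by (cases s)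
  obtain C where "B = add_mset x C" using assms s by (metis fst_conv insert_DiffM)
  then show ?thesis by (cases J) (simp_all add: unwritten_def s)
qed

text \<open>While \<open>a\<close> has unread input, its buffer holds \<open>M\<close> elements, no
  fewer than that of \<open>s\<close>. Comparing the totals of unwritten elements therefore compares
  the lengths of two suffixes of \<open>I\<close>.\<close>

lemma dominates_mset_unread:
  assumes "dominates M I a s"
  shows "mset (snd a) \<subseteq># mset (snd s)"
proof (cases "snd a = []")
  case False
  obtain m n where m: "snd a = drop m I" and n: "snd s = drop n I"
    using assms by (auto simp: dominates_def full_buffer_def)
  have "size (unwritten a) \<le> size (unwritten s)"
    using assms by (auto simp: dominates_def intro: size_mset_mono)
  then have "length (snd a) \<le> length (snd s)"
    using assms False by (auto simp: dominates_def full_buffer_def unwritten_def)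
  \<comment> \<open>As \<open>snd a\<close> is nonempty, \<open>m\<close> lies inside
    \<open>I\<close>, so the lengths of the suffixes order the offsets.\<close>
  then have "n \<le> m" using False m n by simp
  then have "snd a = drop (m - n) (snd s)" using m n by simp
  then have "mset (take (m - n) (snd s)) + mset (snd a) = mset (snd s)"
    by (metis append_take_drop_id mset_append)
  then show ?thesis by (metis mset_subset_eq_add_right)
qed simp

lemma dominates_write_both:
  assumes "dominates M I a s" "x \<in># fst a" "x \<in># fst s"
  shows "dominates M I (write_elem x a) (write_elem x s)"
  using assms unwritten_write_elem[OF assms(2)] unwritten_write_elem[OF assms(3)]
  by (auto simp: dominates_def full_buffer_write_elem)

lemma dominates_write_left:
  assumes "dominates M I a s" "x \<in># fst a"
  shows "dominates M I (write_elem x a) s"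
  using assms unwritten_write_elem[OF assms(2)]
  by (auto simp: dominates_def full_buffer_write_elem dest: mset_subset_eq_insertD subset_mset.less_imp_le)

lemma dominates_write_right:
  assumes "dominates M I a s" "x \<notin># fst a" "x \<in># fst s"
  shows "dominates M I a (write_elem x s)"
proof -
  have sub: "unwritten a \<subseteq># unwritten s"
    using assms(1) by (simp add: dominates_def)
  have "count (mset (snd a)) x \<le> count (mset (snd s)) x"
    using dominates_mset_unread[OF assms(1)] by (simp add: mset_subset_eq_count)
  moreover have "count (fst a) x = 0" "count (fst s) x > 0"
    using assms(2,3) by (auto simp: count_eq_zero_iff)
  ultimately have "count (unwritten a) x < count (unwritten s) x"
    unfolding unwritten_def count_union by linarith
  \<comment> \<open>Strictness at \<open>x\<close> pays for the copy that \<open>s\<close>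
    loses.\<close>
  then have "count (unwritten a) y \<le> count (unwritten (write_elem x s)) y" for y
    using mset_subset_eq_count[OF sub, of y] unwritten_write_elem[OF assms(3)]
    by (cases "y = x") auto
  then have "unwritten a \<subseteq># unwritten (write_elem x s)"
    by (simp add: subseteq_mset_def)
  then show ?thesis
    using assms by (simp add: dominates_def full_buffer_write_elem)
qed

section \<open>Maximal runs against arbitrary runs, for both directions at once\<close>

text \<open>Increasing and decreasing maximal runs are the instances \<open>(\<le>)\<close> and \<open>(\<ge>)\<close> of \<open>le\<close>.\<close>

inductive maximal_run ::
  "('a \<Rightarrow> 'a \<Rightarrow> bool) \<Rightarrow> 'a \<Rightarrow> 'a state \<Rightarrow> 'a list \<Rightarrow> 'a state \<Rightarrow> bool" for le where
  stop: "(\<And>x. x \<in># fst s \<Longrightarrow> \<not> le l x) \<Longrightarrow> maximal_run le l s [] s"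
| step: "x \<in># fst s \<Longrightarrow> le l x \<Longrightarrow> (\<And>y. y \<in># fst s \<Longrightarrow> le l y \<Longrightarrow> le x y) \<Longrightarrow>
    maximal_run le x (write_elem x s) r s' \<Longrightarrow> maximal_run le l s (x # r) s'"

lemma maximal_run_up_from: "up_from l s = (r, s') \<Longrightarrow> maximal_run (\<le>) l s r s'"
proof (induction l s arbitrary: r s' rule: up_from.induct)
  case (1 l s)
  show ?case
  proof (cases "\<exists>x. x \<in># fst s \<and> l \<le> x")
    case True
    define x where "x = Min {x. x \<in># fst s \<and> l \<le> x}"
    obtain r1 s1 where rec: "up_from x (write_elem x s) = (r1, s1)" by (rule prod.exhaust)
    have eq: "r = x # r1" "s' = s1"
      using 1(2) up_from_step[OF True x_def rec] by auto
    have "x \<le> y" if "y \<in># fst s" "l \<le> y" for y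
      unfolding x_def using that by (intro Min_le) auto
    then show ?thesis
      unfolding eq using Min_next[OF True, folded x_def] 1(1)[OF True x_def rec]
      by (intro maximal_run.step)
  next
    case False
    then show ?thesis using 1(2) up_from_stop[OF False] by (auto intro: maximal_run.stop)
  qed
qed

lemma maximal_run_down_from: "down_from l s = (r, s') \<Longrightarrow> maximal_run (\<ge>) l s r s'"
proof (induction l s arbitrary: r s' rule: down_from.induct)
  case (1 l s)
  show ?case
  proof (cases "\<exists>x. x \<in># fst s \<and> x \<le> l")
    case True
    define x where "x = Max {x. x \<in># fst s \<and> x \<le> l}"
    obtain r1 s1 where rec: "down_from x (write_elem x s) = (r1, s1)" by (rule prod.exhaust)
    have eq: "r = x # r1" "s' = s1"
      using 1(2) down_from_step[OF True x_def rec] by auto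
    have "y \<le> x" if "y \<in># fst s" "y \<le> l" for y
      unfolding x_def using that by (intro Max_ge) auto
    then show ?thesis
      unfolding eq using Max_next[OF True, folded x_def] 1(1)[OF True x_def rec]
      by (intro maximal_run.step)
  next
    case False
    then show ?thesis using 1(2) down_from_stop[OF False] by (auto intro: maximal_run.stop)
  qed
qed

lemma maximal_run_sorted_wrt:
  assumes "maximal_run le l s r s'" "transp le"
  shows "sorted_wrt le (l # r)"
  using assms
proof (induction rule: maximal_run.induct)
  case (step x s l r s')
  then have "sorted_wrt le (x # r)" by simp
  then show ?case
    using step.hyps(2) step.prems by (auto dest: transpD)
qed simp

lemma dominates_maximal_run:
  "maximal_run le l a r a' \<Longrightarrow> dominates M I a s \<Longrightarrow> dominates M I a' s"
  by (induction rule: maximal_run.induct) (auto intro: dominates_write_left)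

text \<open>By minimality every element written before \<open>x\<close> is \<open>le\<close>
  \<open>x\<close>, so \<open>x\<close> stays eligible and the run cannot stop without writing it.
  The earlier writes only shrink the dominating side.\<close>

lemma maximal_run_reaches_elem:
  assumes "maximal_run le l a r a'" "x \<in># fst a" "le l x" "dominates M I a s" "x \<in># fst s"
  shows "\<exists>b q. maximal_run le x b q a' \<and> dominates M I b (write_elem x s)"
  using assms
proof (induction rule: maximal_run.induct)
  case (step y a l r a')
  show ?case
  proof (cases "y = x")
    case True
    then show ?thesis
      using step.hyps(4) dominates_write_both[OF step.prems(3,1,4)] by blast
  next
    case False
    have "x \<in># fst (write_elem y a)"
      using False step.prems(1) by (cases a) (auto simp: in_diff_count simp flip: count_greater_zero_iff)
    then show ?thesis
      using step.IH step.hyps(3)[OF step.prems(1,2)] dominates_write_left[OF step.prems(3) step.hyps(1)]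
        step.prems(4) by blast
  qed
qed blast

text \<open>The bound on \<open>r\<close> concerns only elements buffered in \<open>a\<close>:
  others may lie before \<open>l\<close>, and the dominated state writes them alone. Once
  \<open>x\<close> is reached, sortedness makes it a bound for the rest of \<open>r\<close>.\<close>

lemma maximal_run_dominates_run:
  assumes "maximal_run le l a q a'" "dominates M I a s" "outputs s (r @ T)" "sorted_wrt le r"
    and "\<And>y. y \<in># fst a \<Longrightarrow> y \<in> set r \<Longrightarrow> le l y"
  shows "\<exists>s'. dominates M I a' s' \<and> outputs s' T"
  using assms
proof (induction r arbitrary: l a q s)
  case Nil
  then show ?case using dominates_maximal_run by fastforce
next
  case (Cons x r)
  from Cons.prems(3) have x: "x \<in># fst s" and out: "outputs (write_elem x s) (r @ T)"
    by (auto elim: outputs.cases)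
  show ?case
  proof (cases "x \<in># fst a")
    case True
    then obtain b p where "maximal_run le x b p a'" "dominates M I b (write_elem x s)"
      using maximal_run_reaches_elem[OF Cons.prems(1) True _ Cons.prems(2) x] Cons.prems(5) by auto
    then show ?thesis
      using Cons.IH[OF _ _ out] Cons.prems(4) by auto
  next
    case False
    show ?thesis
      using Cons.IH[OF Cons.prems(1) dominates_write_right[OF Cons.prems(2) False x] out]
        Cons.prems(4,5) by auto
  qed
qed

section \<open>The runs written by the alternating algorithm\<close>

lemma is_run_sorted_wrt: "is_run r \<longleftrightarrow> sorted_wrt (\<le>) r \<or> sorted_wrt (\<ge>) r"
  by (simp add: is_run_def sorted_wrt_rev)

definition next_run :: "bool \<Rightarrow> 'a::linorder state \<Rightarrow> 'a list \<times> 'a state" where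
  "next_run up s = (if up then up_run s else down_run s)"

definition le_dir :: "bool \<Rightarrow> 'a::linorder \<Rightarrow> 'a \<Rightarrow> bool" where
  "le_dir up = (if up then (\<le>) else (\<ge>))"

lemma next_run_maximal:
  assumes "next_run up s = (r, s')"
  shows "\<exists>l. maximal_run (le_dir up) l s r s' \<and> (\<forall>y. y \<in># fst s \<longrightarrow> le_dir up l y)"
proof (cases up)
  case True
  then show ?thesis
    using assms maximal_run_up_from[of "Min_mset (fst s)" s r s']
    by (auto simp: next_run_def up_run_def le_dir_def intro!: exI[of _ "Min_mset (fst s)"])
next
  case False
  then show ?thesis
    using assms maximal_run_down_from[of "Max_mset (fst s)" s r s']
    by (auto simp: next_run_def down_run_def le_dir_def intro!: exI[of _ "Max_mset (fst s)"])
qed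

lemma next_run_is_run:
  assumes "next_run up s = (r, s')"
  shows "is_run r"
proof -
  obtain l where l: "maximal_run (le_dir up) l s r s'"
    using next_run_maximal[OF assms] by blast
  have "transp (le_dir up :: 'a \<Rightarrow> 'a \<Rightarrow> bool)"
    by (auto simp: le_dir_def transp_def)
  with maximal_run_sorted_wrt[OF l] show ?thesis
    by (auto simp: le_dir_def is_run_sorted_wrt split: if_splits)
qed

lemma dominates_next_run:
  assumes "next_run up a = (q, a')" "dominates M I a s"
  shows "dominates M I a' s"
  using next_run_maximal[OF assms(1)] dominates_maximal_run[OF _ assms(2)] by metis

lemma next_run_dominates_run:
  assumes "next_run up a = (q, a')" "dominates M I a s" "outputs s (r @ T)"
    "sorted_wrt (le_dir up) r"
  shows "\<exists>s'. dominates M I a' s' \<and> outputs s' T"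
  using next_run_maximal[OF assms(1)] maximal_run_dominates_run[OF _ assms(2-)] by metis

text \<open>An empty buffer yields an empty run, so unfolding two runs at a time needs no case
  distinction.\<close>

lemma alternate_next_run:
  assumes "next_run up s = (r, s')"
  shows "alternate up s = r @ alternate (\<not> up) s'"
proof (cases "fst s = {#}")
  case True
  then have "r = [] \<and> s' = s"
    using assms by (auto simp: next_run_def up_run_def down_run_def up_from_stop down_from_stop
        split: if_splits)
  then show ?thesis using True by (simp add: alternate.simps)
next
  case False
  then show ?thesis
    using assms by (subst alternate.simps) (simp add: next_run_def)
qed

section \<open>Counting runs against the optimum\<close>

lemma alternate_runs:
  assumes "dominates M I a s" "outputs s (concat rs)" "\<forall>r\<in>set rs. is_run r"
  shows "\<exists>qs. length qs \<le> 2 * length rs \<and> concat qs = alternate up a \<and> (\<forall>q\<in>set qs. is_run q)"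
  using assms
proof (induction rs arbitrary: a s)
  case Nil
  from Nil.prems(2) have "s = ({#}, [])" by (auto elim: outputs.cases)
  then have "fst a = {#}" using Nil.prems(1) by (auto simp: dominates_def unwritten_def)
  then show ?case by (simp add: alternate.simps)
next
  case (Cons r rs)
  obtain q1 a1 where 1: "next_run up a = (q1, a1)" by (rule prod.exhaust)
  obtain q2 a2 where 2: "next_run (\<not> up) a1 = (q2, a2)" by (rule prod.exhaust)
  have out: "outputs s (r @ concat rs)" using Cons.prems(2) by simp
  have "sorted_wrt (le_dir up) r \<or> sorted_wrt (le_dir (\<not> up)) r"
    using Cons.prems(3) by (auto simp: is_run_sorted_wrt le_dir_def)
  \<comment> \<open>Either the first run catches up with \<open>r\<close> and the second preserves
    domination, or the first preserves it and the second catches up.\<close>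
  then obtain s' where "dominates M I a2 s'" "outputs s' (concat rs)"
    using next_run_dominates_run[OF 1 Cons.prems(1) out] dominates_next_run[OF 2]
      next_run_dominates_run[OF 2 dominates_next_run[OF 1 Cons.prems(1)] out] by blast
  \<comment> \<open>Two alternations restore the flag, so the induction hypothesis applies with the
    same \<open>up\<close>.\<close>
  then obtain qs where "length qs \<le> 2 * length rs" "concat qs = alternate up a2"
      "\<forall>q\<in>set qs. is_run q"
    using Cons.IH[of a2 s'] Cons.prems(3) by auto
  then have "length (q1 # q2 # qs) \<le> 2 * length (r # rs)"
      "concat (q1 # q2 # qs) = alternate up a" "\<forall>q\<in>set (q1 # q2 # qs). is_run q"
    using alternate_next_run[OF 1] alternate_next_run[OF 2] next_run_is_run[OF 1] next_run_is_run[OF 2]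
    by auto
  then show ?case by blast
qed

lemma num_runs_attained: "\<exists>rs. length rs = num_runs S \<and> concat rs = S \<and> (\<forall>r\<in>set rs. is_run r)"
proof -
  \<comment> \<open>Cutting into singletons shows that the \<open>LEAST\<close> ranges over a
    nonempty set.\<close>
  have "concat (map (\<lambda>x. [x]) S) = S \<and> (\<forall>r\<in>set (map (\<lambda>x. [x]) S). is_run r)"
    by (auto simp: is_run_def)
  then have "\<exists>k rs. length rs = k \<and> concat rs = S \<and> (\<forall>r\<in>set rs. is_run r)" by blast
  then show ?thesis unfolding num_runs_def by (rule LeastI_ex)
qed

lemma num_runs_le: "\<forall>r\<in>set rs. is_run r \<Longrightarrow> num_runs (concat rs) \<le> length rs"
  unfolding num_runs_def by (rule Least_le) blast

theorem theorem3:
  fixes M :: nat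
  assumes "M \<ge> 1"
  shows "competitive M 2 (updown_rs M :: 'a::linorder list \<Rightarrow> 'a list)"
  unfolding competitive_def
proof
  fix I :: "'a list"
  have "\<exists>k S. outputs (initial M I) S \<and> num_runs S = k"
    using updown_rs_outputs[OF assms] by blast
  then have "\<exists>S. outputs (initial M I) S \<and> num_runs S = opt_runs M I"
    unfolding opt_runs_def by (rule LeastI_ex)
  then obtain S where S: "outputs (initial M I) S" "num_runs S = opt_runs M I" by blast
  obtain rs where rs: "length rs = opt_runs M I" "concat rs = S" "\<forall>r\<in>set rs. is_run r"
    using num_runs_attained[of S] S(2) by auto
  have "dominates M I (initial M I) (initial M I)"
    by (simp add: dominates_def full_buffer_initial)
  then obtain qs where "length qs \<le> 2 * length rs" "concat qs = updown_rs M I"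
      "\<forall>q\<in>set qs. is_run q"
    using alternate_runs[of M I "initial M I" "initial M I" rs True] S(1) rs(2,3)
    by (auto simp: updown_rs_def)
  then have "num_runs (updown_rs M I) \<le> 2 * opt_runs M I"
    using num_runs_le[of qs] rs(1) by simp
  then show "real (num_runs (updown_rs M I)) \<le> 2 * real (opt_runs M I)" by simp
qed

end
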